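(* Let $G$ be a finite loopless multigraph with maximum degree $\Delta(G)\leq 3$. Then $G$ admits an incidence coloring with at most $6$ colors.
   Context: All (multi)graphs are finite, undirected and without loops; multigraphs may have parallel edges, and the degree of a vertex is the number of edges incident to it. An incidence of $G$ is a pair $(v,e)$ where $v$ is a vertex of $G$ incident to the edge $e$. Two distinct incidences $(v,e)$ and $(w,f)$ are adjacent if one of the following holds: $v=w$; or $e=f$; or $vw\in\{e,f\}$ (i.e. at least one of the edges $e,f$ has endpoints $v$ and $w$). An incidence coloring of $G$ assigns a color to each incidence of $G$ such that adjacent incidences get distinct colors. (Equivalently, it is a strong edge-coloring of the graph obtained from $G$ by subdividing each edge exactly once.) *)

theory Defs
  imports Main
begin

text \<open>
  Undirected multigraphs: edges are abstract objects, and \<open>ends\<close> maps an edge to the set of its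
  end vertices. Parallel edges are distinct edges with the same ends; looplessness is the
  requirement that every edge has exactly two ends.
\<close>

record ('v, 'e) multigraph =
  verts :: "'v set"
  edges :: "'e set"
  ends  :: "'e \<Rightarrow> 'v set"

locale finite_loopless_multigraph =
  fixes G :: "('v, 'e) multigraph"
  assumes finite_verts: "finite (verts G)"
    and finite_edges: "finite (edges G)"
    and ends_subset_verts: "e \<in> edges G \<Longrightarrow> ends G e \<subseteq> verts G"
    and card_ends: "e \<in> edges G \<Longrightarrow> card (ends G e) = 2"

definition degree :: "('v, 'e) multigraph \<Rightarrow> 'v \<Rightarrow> nat" where
  "degree G v = card {e \<in> edges G. v \<in> ends G e}"

text \<open>Inserting \<open>0\<close> only matters for the graph without vertices, whose maximum degree is \<open>0\<close>.\<close>

definition max_degree :: "('v, 'e) multigraph \<Rightarrow> nat" where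
  "max_degree G = Max (insert 0 (degree G ` verts G))"

definition incidences :: "('v, 'e) multigraph \<Rightarrow> ('v \<times> 'e) set" where
  "incidences G = {(v, e). v \<in> verts G \<and> e \<in> edges G \<and> v \<in> ends G e}"

definition adjacent_incidences ::
  "('v, 'e) multigraph \<Rightarrow> 'v \<times> 'e \<Rightarrow> 'v \<times> 'e \<Rightarrow> bool" where
  "adjacent_incidences G = (\<lambda>(v, e) (w, f).
     (v, e) \<noteq> (w, f) \<and> (v = w \<or> e = f \<or> ends G e = {v, w} \<or> ends G f = {v, w}))"

definition incidence_coloring :: "('v, 'e) multigraph \<Rightarrow> ('v \<times> 'e \<Rightarrow> 'c) \<Rightarrow> bool" where
  "incidence_coloring G c \<longleftrightarrow>
     (\<forall>i \<in> incidences G. \<forall>j \<in> incidences G. adjacent_incidences G i j \<longrightarrow> c i \<noteq> c j)"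

end

theory Submission
  imports Defs
begin

text \<open>
  An incidence \<open>(v, e)\<close> can be read as the arc that leaves \<open>v\<close> along \<open>e\<close>. Two arcs conflict exactly
  when they have the same tail or when the head of one is the tail of the other; in particular
  arcs on edges without a common end never conflict, and neither do arcs from different vertices
  into a common head.

  A linear forest (a disjoint union of paths) needs only three colours: removing a pendant edge and
  colouring the rest, there is always a free colour for each of the two new incidences
  (\<open>linear_forest_three_colours\<close>). So if the edges of \<open>G\<close> split into two linear forests
  \<open>A\<close> and \<open>B\<close>, disjoint palettes for \<open>A\<close> and \<open>B\<close> give six colours. Such a
  splitting need not exist: two vertices joined by three edges have none. Instead, choose
  disjoint linear forests \<open>A\<close> and \<open>B\<close> covering as many edges as possible. Then every uncovered edge
  \<open>e\<close>, with ends \<open>u\<close> and \<open>v\<close> in a suitable order, is of one of two kinds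
  (\<open>residual_or_augmentable\<close>):

  \<^item> \<open>u\<close> has its other two edges in \<open>A\<close>, and \<open>v\<close> has its other two edges in \<open>B\<close>;

  \<^item> \<open>e\<close> is parallel to an edge of \<open>A\<close> and to an edge of \<open>B\<close>.

  Otherwise \<open>A\<close> or \<open>B\<close> could absorb \<open>e\<close>, possibly after an exchange. The one hard case is that each
  of \<open>u\<close> and \<open>v\<close> has one edge in \<open>A\<close> and one in \<open>B\<close>, and \<open>e\<close> closes a cycle with both forests. Unless
  \<open>e\<close> is of the second kind, one of the two cycles, say the one in \<open>A\<close>, has length at least three,
  so the edge \<open>g = ux\<close> of \<open>A\<close> at \<open>u\<close> has \<open>x \<noteq> v\<close>. Putting \<open>e\<close> into \<open>A\<close> and moving \<open>g\<close> to \<open>B\<close> keeps both linear forests, because the path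
  of \<open>B\<close> starting at \<open>u\<close> ends at \<open>v\<close> and therefore avoids \<open>x\<close> (\<open>exchange_step\<close>).

  The uncovered edges form a matching, and on each of them both incidences can take one of the
  six colours. In the first kind, the incidence at \<open>v\<close> sees colours of the
  palette of \<open>A\<close> only on the two incidences of \<open>A\<close> at \<open>u\<close>, so one colour of that
  palette is free, and symmetrically for the incidence at \<open>u\<close>. In the second kind, each of
  the two parallel edges uses only two of the three colours of its palette
  (\<open>extend_over_residual_edges\<close>).
\<close>

context finite_loopless_multigraph
begin

section \<open>Degrees in edge sets\<close>

definition star :: "'e set \<Rightarrow> 'v \<Rightarrow> 'e set" where
  "star F v = {e \<in> F. v \<in> ends G e}"

definition deg :: "'e set \<Rightarrow> 'v \<Rightarrow> nat" where
  "deg F v = card (star F v)"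

lemma finite_star: "F \<subseteq> edges G \<Longrightarrow> finite (star F v)"
  unfolding star_def using finite_edges by (auto intro: finite_subset)

lemma star_mono: "F \<subseteq> F' \<Longrightarrow> star F v \<subseteq> star F' v"
  by (auto simp: star_def)

lemma deg_mono: "F \<subseteq> F' \<Longrightarrow> F' \<subseteq> edges G \<Longrightarrow> deg F v \<le> deg F' v"
  unfolding deg_def by (intro card_mono finite_star star_mono)

lemma deg_0_iff: "F \<subseteq> edges G \<Longrightarrow> deg F v = 0 \<longleftrightarrow> (\<forall>e \<in> F. v \<notin> ends G e)"
  using finite_star[of F v] by (auto simp: deg_def star_def)

lemma deg_insert:
  assumes "F \<subseteq> edges G" "e \<notin> F"
  shows "deg (insert e F) v = deg F v + (if v \<in> ends G e then 1 else 0)"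
proof -
  have "star (insert e F) v = (if v \<in> ends G e then insert e (star F v) else star F v)"
    by (auto simp: star_def)
  moreover have "e \<notin> star F v"
    using assms(2) by (simp add: star_def)
  ultimately show ?thesis
    using finite_star[OF assms(1), of v] by (simp add: deg_def)
qed

lemma deg_Un:
  assumes "A \<subseteq> edges G" "B \<subseteq> edges G" "A \<inter> B = {}"
  shows "deg (A \<union> B) v = deg A v + deg B v"
proof -
  have "star (A \<union> B) v = star A v \<union> star B v" "star A v \<inter> star B v = {}"
    using assms(3) by (auto simp: star_def)
  then show ?thesis
    using finite_star[OF assms(1)] finite_star[OF assms(2)] by (simp add: deg_def card_Un_disjoint)
qed

lemma deg_eq_1_ex:
  assumes "deg F v = 1"
  shows "\<exists>e \<in> F. v \<in> ends G e"
  using assms by (auto simp: deg_def star_def card_1_singleton_iff)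

lemma deg_eq_1_unique:
  assumes "deg F v = 1" "e \<in> F" "v \<in> ends G e" "f \<in> F" "v \<in> ends G f"
  shows "e = f"
proof -
  obtain g where "star F v = {g}"
    using assms(1) by (auto simp: deg_def card_1_singleton_iff)
  moreover have "e \<in> star F v" "f \<in> star F v"
    using assms by (auto simp: star_def)
  ultimately show ?thesis
    by simp
qed

lemma other_end:
  assumes "e \<in> edges G" "u \<in> ends G e"
  obtains v where "ends G e = {u, v}" "u \<noteq> v"
proof -
  obtain a b where "ends G e = {a, b}" "a \<noteq> b"
    using card_ends[OF assms(1)] by (auto simp: card_2_iff)
  then show ?thesis
    using assms(2) that[of a] that[of b] by auto
qed

text \<open>The handshake identity makes the sum of all degrees even.\<close>

lemma exists_other_odd_vertex:
  assumes F: "F \<subseteq> edges G" and u: "odd (deg F u)"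
  obtains w where "w \<noteq> u" "odd (deg F w)"
proof -
  have "(\<Sum>v\<in>verts G. deg F v) = 2 * card F"
    unfolding deg_def star_def
  proof (rule sum_multicount)
    show "finite (verts G)" "finite F"
      using finite_verts finite_edges F by (auto intro: finite_subset)
    show "\<forall>e\<in>F. card {v \<in> verts G. v \<in> ends G e} = 2"
    proof
      fix e assume "e \<in> F"
      then have "{v \<in> verts G. v \<in> ends G e} = ends G e" "card (ends G e) = 2"
        using F ends_subset_verts[of e] card_ends[of e] by auto
      then show "card {v \<in> verts G. v \<in> ends G e} = 2"
        by simp
    qed
  qed
  moreover have "u \<in> verts G"
  proof -
    have "deg F u \<noteq> 0"
      using u by (metis even_zero)
    then show ?thesis
      using F ends_subset_verts by (auto simp: deg_0_iff)
  qed
  ultimately have "even (deg F u + (\<Sum>v\<in>verts G - {u}. deg F v))"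
    using finite_verts by (simp add: sum.remove[symmetric])
  then have "odd (\<Sum>v\<in>verts G - {u}. deg F v)"
    using u by simp
  then have "\<exists>w\<in>verts G - {u}. odd (deg F w)"
    using dvd_sum[of "verts G - {u}" 2 "deg F"] by blast
  then show ?thesis
    using that by blast
qed

section \<open>Linear forests\<close>

text \<open>
  No vertex has degree one in a cycle, and conversely every nonempty finite edge set without a
  vertex of degree one contains a cycle. This formulation avoids walks altogether, and it
  provides directly the pendant edge on which the colouring of a forest proceeds by induction.
\<close>

definition acyclic_edges :: "'e set \<Rightarrow> bool" where
  "acyclic_edges F \<longleftrightarrow> (\<forall>S \<subseteq> F. S \<noteq> {} \<longrightarrow> (\<exists>v. deg S v = 1))"

definition linear_forest :: "'e set \<Rightarrow> bool" where
  "linear_forest F \<longleftrightarrow> F \<subseteq> edges G \<and> (\<forall>v. deg F v \<le> 2) \<and> acyclic_edges F"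

lemma linear_forest_subset:
  assumes "linear_forest F" "F' \<subseteq> F"
  shows "linear_forest F'"
proof -
  have "deg F' v \<le> 2" for v
    using deg_mono[OF assms(2), of v] assms(1) by (auto simp: linear_forest_def intro: order_trans)
  then show ?thesis
    using assms by (auto simp: linear_forest_def acyclic_edges_def)
qed

lemma acyclic_insert_pendant:
  assumes "acyclic_edges F" "F \<subseteq> edges G" "e \<notin> F" "u \<in> ends G e" "deg F u = 0"
  shows "acyclic_edges (insert e F)"
  unfolding acyclic_edges_def
proof (intro allI impI)
  fix S assume S: "S \<subseteq> insert e F" "S \<noteq> {}"
  show "\<exists>v. deg S v = 1"
  proof (cases "e \<in> S")
    case True
    have sub: "S - {e} \<subseteq> F"
      using S by auto
    then have "deg (insert e (S - {e})) u = 1"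
      using deg_mono[OF sub assms(2), of u] assms(2,4,5) by (subst deg_insert) auto
    then show ?thesis
      using True by (auto simp: insert_absorb)
  next
    case False
    then show ?thesis
      using S assms(1) by (auto simp: acyclic_edges_def)
  qed
qed

lemma linear_forest_insert:
  assumes F: "linear_forest F" and e: "e \<in> edges G" "e \<notin> F"
    and deg: "\<And>z. z \<in> ends G e \<Longrightarrow> deg F z \<le> 1"
    and ac: "acyclic_edges (insert e F)"
  shows "linear_forest (insert e F)"
proof -
  have "deg (insert e F) z \<le> 2" for z
    using F e deg[of z] by (auto simp: linear_forest_def deg_insert)
  then show ?thesis
    using F e ac by (simp add: linear_forest_def)
qed

lemma linear_forest_insert_pendant:
  assumes F: "linear_forest F" and e: "e \<in> edges G" "e \<notin> F" "ends G e = {u, v}"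
    and deg: "deg F u = 0" "deg F v \<le> 1"
  shows "linear_forest (insert e F)"
  using assms by (intro linear_forest_insert acyclic_insert_pendant[where u = u])
    (auto simp: linear_forest_def)

text \<open>
  A nonempty set without vertices of degree one must contain \<open>e\<close>, as \<open>F\<close> is acyclic. Removing \<open>e\<close> from
  it gives \<open>S\<close>: the ends of \<open>e\<close>, of degree at least two before, keep an edge.
\<close>

lemma cycle_through_new_edge:
  assumes F: "F \<subseteq> edges G" "acyclic_edges F" and e: "e \<notin> F"
    and cyc: "\<not> acyclic_edges (insert e F)"
  obtains S where "S \<subseteq> F" "\<And>z. z \<in> ends G e \<Longrightarrow> deg S z \<noteq> 0"
    "\<And>z. z \<notin> ends G e \<Longrightarrow> deg S z \<noteq> 1"
proof -
  obtain T where T: "T \<subseteq> insert e F" "T \<noteq> {}" "\<And>v. deg T v \<noteq> 1"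
    using cyc by (auto simp: acyclic_edges_def)
  have "e \<in> T"
    using T F(2) unfolding acyclic_edges_def by blast
  have sub: "T - {e} \<subseteq> F"
    using T(1) by auto
  have "deg T z = deg (T - {e}) z + (if z \<in> ends G e then 1 else 0)" for z
    using deg_insert[of "T - {e}" e z] \<open>e \<in> T\<close> sub F(1) by (auto simp: insert_absorb)
  then show ?thesis
    using that[OF sub] T(3) by (metis add.right_neutral add_0)
qed

text \<open>
  In a linear forest, a path that starts at \<open>u\<close> has only one other end, so two edges from \<open>u\<close> to
  distinct vertices of degree at most one cannot both close a cycle. If they did,
  with remainders \<open>S\<close> and \<open>T\<close>, then \<open>S \<inter> T\<close> would have odd degree at \<open>u\<close> alone.
\<close>

lemma two_cycles_through_path_end:
  assumes F: "linear_forest F" and e: "e \<notin> F" "ends G e = {u, v}"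
    and g: "g \<notin> F" "ends G g = {u, x}"
    and distinct: "u \<noteq> v" "u \<noteq> x" "v \<noteq> x"
    and deg: "deg F u \<le> 1" "deg F v \<le> 1" "deg F x \<le> 1"
    and cyc: "\<not> acyclic_edges (insert e F)"
  shows "acyclic_edges (insert g F)"
proof (rule ccontr)
  assume cyc': "\<not> acyclic_edges (insert g F)"
  have FE: "F \<subseteq> edges G" and ac: "acyclic_edges F" and le2: "\<And>z. deg F z \<le> 2"
    using F by (auto simp: linear_forest_def)
  obtain S where S: "S \<subseteq> F" "deg S u \<noteq> 0" "deg S v \<noteq> 0"
      "\<And>z. z \<notin> {u, v} \<Longrightarrow> deg S z \<noteq> 1"
    using cycle_through_new_edge[OF FE ac e(1) cyc] e(2) by (metis insertI1 insertI2)
  obtain T where T: "T \<subseteq> F" "deg T u \<noteq> 0" "deg T x \<noteq> 0"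
      "\<And>z. z \<notin> {u, x} \<Longrightarrow> deg T z \<noteq> 1"
    using cycle_through_new_edge[OF FE ac g(1) cyc'] g(2) by (metis insertI1 insertI2)
  have le: "deg S z \<le> deg F z" "deg T z \<le> deg F z" for z
    using S(1) T(1) FE by (auto intro: deg_mono)
  \<comment> \<open>At a vertex where \<open>S\<close> and \<open>T\<close> both contain every edge of \<open>F\<close>, so does \<open>S \<inter> T\<close>;
    where one of them has no edge, neither has \<open>S \<inter> T\<close>. No other vertices occur.\<close>
  have full: "deg (S \<inter> T) z = deg F z" if "deg S z = deg F z" "deg T z = deg F z" for z
  proof -
    have "star S z = star F z" "star T z = star F z"
      using that S(1) T(1) card_subset_eq[OF finite_star[OF FE, of z]] star_mono
      unfolding deg_def by metis+
    then have "star (S \<inter> T) z = star F z"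
      by (auto simp: star_def)
    then show ?thesis
      by (simp add: deg_def)
  qed
  have empty: "deg (S \<inter> T) z = 0" if "deg S z = 0 \<or> deg T z = 0" for z
  proof -
    have "deg (S \<inter> T) z \<le> deg S z" "deg (S \<inter> T) z \<le> deg T z"
      using S(1) T(1) FE by (auto intro!: deg_mono)
    then show ?thesis
      using that by auto
  qed
  have "deg (S \<inter> T) u = deg F u" "deg F u = 1"
    using S(2) T(2) deg(1) le[of u] by (auto intro!: full)
  then have "odd (deg (S \<inter> T) u)"
    by simp
  moreover have "S \<inter> T \<subseteq> edges G"
    using S(1) FE by auto
  ultimately obtain z where z: "z \<noteq> u" "odd (deg (S \<inter> T) z)"
    using exists_other_odd_vertex by blast
  consider "z = v" | "z = x" | "z \<notin> {u, v, x}"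
    using z(1) by auto
  then show False
  proof cases
    case 1
    then have "deg T z = 0"
      using T(4)[of z] le(2)[of z] deg(2) distinct by auto
    then show False
      using empty[of z] z(2) by simp
  next
    case 2
    then have "deg S z = 0"
      using S(4)[of z] le(1)[of z] deg(3) distinct by auto
    then show False
      using empty[of z] z(2) by simp
  next
    case 3
    then have "deg S z \<noteq> 1" "deg T z \<noteq> 1"
      using S(4)[of z] T(4)[of z] by auto
    then have "deg (S \<inter> T) z = 0 \<or> (deg S z = 2 \<and> deg T z = 2 \<and> deg F z = 2)"
      using empty[of z] le[of z] le2[of z] by linarith
    then show False
      using full[of z] z(2) by auto
  qed
qed

section \<open>Two linear forests covering most edges\<close>

text \<open>
  After the exchange, \<open>e\<close> is pendant at \<open>u\<close> in the first forest, as \<open>g\<close> was the only edge of \<open>A\<close> at \<open>u\<close>.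
  In the second forest, \<open>g\<close> could only close a cycle if the path of \<open>B\<close> from \<open>u\<close> ended at the
  other end \<open>x\<close> of \<open>g\<close>; but it ends at \<open>v\<close>, since \<open>e\<close> closes a cycle with \<open>B\<close>.
\<close>

lemma exchange_step:
  assumes A: "linear_forest A" and B: "linear_forest B" and AB: "A \<inter> B = {}"
    and max3: "\<And>z. deg (edges G) z \<le> 3"
    and e: "e \<in> edges G" "e \<notin> A \<union> B" "ends G e = {u, v}" "u \<noteq> v"
    and degA: "deg A u = 1" "deg A v = 1" and degB: "deg B u = 1" "deg B v = 1"
    and cycA: "\<not> acyclic_edges (insert e A)" and cycB: "\<not> acyclic_edges (insert e B)"
    and g: "g \<in> A" "u \<in> ends G g" "ends G g \<noteq> {u, v}"
  shows "linear_forest (insert e (A - {g}))" "linear_forest (insert g B)"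
proof -
  have AE: "A \<subseteq> edges G" "acyclic_edges A" and BE: "B \<subseteq> edges G"
    using A B by (auto simp: linear_forest_def)
  obtain x where x: "ends G g = {u, x}" "u \<noteq> x"
    using other_end[of g u] g AE by blast
  have "v \<noteq> x"
    using x g(3) by auto
  have "A - {g} \<subseteq> edges G" "insert g (A - {g}) = A"
    using AE(1) g(1) by auto
  then have deg_split: "deg A z = deg (A - {g}) z + (if z \<in> ends G g then 1 else 0)" for z
    using deg_insert[of "A - {g}" g z] by simp
  show "linear_forest (insert e (A - {g}))"
  proof (rule linear_forest_insert_pendant)
    show "linear_forest (A - {g})"
      using A by (rule linear_forest_subset) auto
    show "deg (A - {g}) u = 0" "deg (A - {g}) v \<le> 1"
      using deg_split[of u] deg_split[of v] degA x by auto
  qed (use e in auto)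
  \<comment> \<open>The vertex \<open>x\<close> is interior to the path of \<open>A\<close> from \<open>u\<close> to \<open>v\<close>, which leaves at most one edge of \<open>B\<close> at \<open>x\<close>.\<close>
  obtain S where S: "S \<subseteq> A" "deg S u \<noteq> 0" "\<And>z. z \<notin> {u, v} \<Longrightarrow> deg S z \<noteq> 1"
    using cycle_through_new_edge[OF AE _ cycA] e(2,3) by (metis UnI1 insertI1)
  have SE: "S \<subseteq> edges G"
    using S(1) AE by auto
  have "g \<in> S"
  proof -
    obtain f where "f \<in> S" "u \<in> ends G f"
      using S(2) SE by (auto simp: deg_0_iff)
    moreover from this have "f = g"
      using S(1) g by (intro deg_eq_1_unique[OF degA(1)]) auto
    ultimately show ?thesis
      by simp
  qed
  then have "deg S x \<noteq> 0"
    using x SE by (auto simp: deg_0_iff)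
  then have "deg A x \<ge> 2"
    using S(3)[of x] x \<open>v \<noteq> x\<close> deg_mono[OF S(1) AE(1), of x] by auto
  moreover have "deg A x + deg B x \<le> 3"
    using deg_Un[OF AE(1) BE AB, of x] deg_mono[of "A \<union> B" "edges G" x] max3[of x] AE BE by auto
  ultimately have degBx: "deg B x \<le> 1"
    by linarith
  have gB: "g \<notin> B"
    using g AB by auto
  have "acyclic_edges (insert g B)"
    using two_cycles_through_path_end[OF B _ e(3) gB x(1) e(4) x(2) \<open>v \<noteq> x\<close> _ _ degBx cycB]
      e(2) degB by auto
  then show "linear_forest (insert g B)"
    using B g AE gB degB degBx x by (intro linear_forest_insert) auto
qed

text \<open>
  These are the edges that maximality of \<open>A \<union> B\<close> does not exclude. In both kinds the two ends
  of \<open>e\<close> already have two edges in \<open>A \<union> B\<close>, so under maximum degree three no two residual edges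
  outside \<open>A \<union> B\<close> share an end.
\<close>

definition residual_edge :: "'e set \<Rightarrow> 'e set \<Rightarrow> 'e \<Rightarrow> bool" where
  "residual_edge A B e \<longleftrightarrow> (\<exists>u v. ends G e = {u, v} \<and> u \<noteq> v \<and>
     (deg A u = 2 \<and> deg B u = 0 \<and> deg A v = 0 \<and> deg B v = 2 \<or>
      deg A u = 1 \<and> deg B u = 1 \<and> deg A v = 1 \<and> deg B v = 1 \<and>
      (\<exists>g \<in> A. ends G g = {u, v}) \<and> (\<exists>h \<in> B. ends G h = {u, v})))"

text \<open>
  If one end has no edge in a forest, then \<open>e\<close> can be added to that forest as a pendant edge unless
  the other end already has degree two there; the degree bound then forces the first kind of
  residual edge. Otherwise all four degrees are one, and \<open>exchange_step\<close> leaves only parallel edges.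
\<close>

lemma residual_or_augmentable:
  assumes A: "linear_forest A" and B: "linear_forest B" and AB: "A \<inter> B = {}"
    and max3: "\<And>z. deg (edges G) z \<le> 3"
    and e: "e \<in> edges G" "e \<notin> A \<union> B"
    and maximal: "\<And>A' B'. linear_forest A' \<Longrightarrow> linear_forest B' \<Longrightarrow> A' \<inter> B' = {} \<Longrightarrow>
      A' \<union> B' \<noteq> insert e (A \<union> B)"
  shows "residual_edge A B e"
proof -
  obtain u v where uv: "ends G e = {u, v}" "u \<noteq> v"
    using card_ends[OF e(1)] by (auto simp: card_2_iff)
  have AE: "A \<subseteq> edges G" and BE: "B \<subseteq> edges G"
    using A B by (auto simp: linear_forest_def)
  have deg2: "deg A z + deg B z \<le> 2" if "z \<in> {u, v}" for z
  proof -
    have "deg (insert e (A \<union> B)) z \<le> deg (edges G) z"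
      using AE BE e(1) by (intro deg_mono) auto
    then show ?thesis
      using that uv max3[of z] AE BE AB e by (simp add: deg_insert deg_Un split: if_splits)
  qed
  have noA: "\<not> linear_forest (insert e A)"
    using maximal[of "insert e A" B] B AB e by auto
  have noB: "\<not> linear_forest (insert e B)"
    using maximal[of A "insert e B"] A AB e by auto
  have pend: "deg F z' \<ge> 2"
    if "deg F z = 0" "{z, z'} = {u, v}" "linear_forest F" "e \<notin> F" "\<not> linear_forest (insert e F)"
    for F z z'
    using linear_forest_insert_pendant[of F e z z'] that uv e by force
  have swap: "{v, u} = {u, v}"
    by auto
  note pendA = pend[OF _ _ A _ noA] and pendB = pend[OF _ _ B _ noB]
  show ?thesis
  proof (cases "deg A u = 0 \<or> deg B v = 0")
    case True
    then have "deg A v = 2 \<and> deg B v = 0 \<and> deg A u = 0 \<and> deg B u = 2"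
      using pendA[of u v] pendB[of v u] e deg2[of u] deg2[of v] swap by force
    then show ?thesis
      using uv unfolding residual_edge_def by blast
  next
    case F1: False
    show ?thesis
    proof (cases "deg A v = 0 \<or> deg B u = 0")
      case True
      then have "deg A u = 2 \<and> deg B u = 0 \<and> deg A v = 0 \<and> deg B v = 2"
        using pendA[of v u] pendB[of u v] e deg2[of u] deg2[of v] swap by force
      then show ?thesis
        using uv unfolding residual_edge_def by blast
    next
      case F2: False
      then have degs: "deg A u = 1" "deg B u = 1" "deg A v = 1" "deg B v = 1"
        using F1 deg2[of u] deg2[of v] by auto
      have le: "deg A z \<le> 1" "deg B z \<le> 1" if "z \<in> ends G e" for z
        using that uv(1) degs by auto
      have cycA: "\<not> acyclic_edges (insert e A)"
        using noA linear_forest_insert[OF A e(1) _ le(1)] e(2) by (metis UnI1)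
      have cycB: "\<not> acyclic_edges (insert e B)"
        using noB linear_forest_insert[OF B e(1) _ le(2)] e(2) by (metis UnI2)
      obtain g where g: "g \<in> A" "u \<in> ends G g"
        using deg_eq_1_ex[OF degs(1)] by blast
      obtain h where h: "h \<in> B" "u \<in> ends G h"
        using deg_eq_1_ex[OF degs(2)] by blast
      have "ends G g = {u, v}"
      proof (rule ccontr)
        assume "ends G g \<noteq> {u, v}"
        from exchange_step[OF A B AB max3 e uv degs(1,3,2,4) cycA cycB g this]
        show False
          using maximal[of "insert e (A - {g})" "insert g B"] g(1) e(2) AB by auto
      qed
      moreover have "ends G h = {u, v}"
      proof (rule ccontr)
        assume *: "ends G h \<noteq> {u, v}"
        have "B \<inter> A = {}" "e \<notin> B \<union> A"
          using AB e(2) by auto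
        from exchange_step[OF B A this(1) max3 e(1) this(2) uv degs(2,4,1,3) cycB cycA h *]
        show False
          using maximal[of "insert h A" "insert e (B - {h})"] h(1) e(2) AB by auto
      qed
      ultimately show ?thesis
        using uv degs g(1) h(1) unfolding residual_edge_def by blast
    qed
  qed
qed

lemma exists_forests_with_residual_rest:
  assumes max3: "\<And>z. deg (edges G) z \<le> 3"
  obtains A B where "linear_forest A" "linear_forest B" "A \<inter> B = {}"
    "\<And>e. e \<in> edges G \<Longrightarrow> e \<notin> A \<union> B \<Longrightarrow> residual_edge A B e"
proof -
  define good where
    "good = (\<lambda>(A, B). linear_forest A \<and> linear_forest B \<and> A \<inter> B = {})"
  define size where "size = (\<lambda>(A :: 'e set, B). card (A \<union> B))"
  have "linear_forest {}"
    by (auto simp: linear_forest_def acyclic_edges_def deg_def star_def)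
  then have "good ({}, {})"
    by (simp add: good_def)
  moreover have "\<forall>p. good p \<longrightarrow> size p < Suc (card (edges G))"
    using finite_edges
    by (auto simp: good_def size_def linear_forest_def less_Suc_eq_le intro!: card_mono)
  ultimately obtain p where p: "good p" "\<forall>q. good q \<longrightarrow> size q \<le> size p"
    using ex_has_greatest_nat[of good _ size] by blast
  obtain A B where AB: "p = (A, B)"
    by (cases p)
  have A: "linear_forest A" and B: "linear_forest B" and disj: "A \<inter> B = {}"
    using p(1) AB by (auto simp: good_def)
  have "residual_edge A B e" if e: "e \<in> edges G" "e \<notin> A \<union> B" for e
  proof (rule residual_or_augmentable[OF A B disj max3 e])
    fix A' B'
    assume "linear_forest A'" "linear_forest B'" "A' \<inter> B' = {}"
    then have "card (A' \<union> B') \<le> card (A \<union> B)"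
      using p(2) AB by (auto simp: good_def size_def)
    moreover have "finite (A \<union> B)"
      using A B finite_edges by (auto simp: linear_forest_def intro: finite_subset)
    ultimately show "A' \<union> B' \<noteq> insert e (A \<union> B)"
      using e(2) by auto
  qed
  then show ?thesis
    using that A B disj by blast
qed

section \<open>Colouring the incidences\<close>

definition proper_on :: "'e set \<Rightarrow> ('v \<times> 'e \<Rightarrow> nat) \<Rightarrow> bool" where
  "proper_on F c \<longleftrightarrow> (\<forall>e \<in> F. \<forall>f \<in> F. \<forall>v \<in> ends G e. \<forall>w \<in> ends G f.
     adjacent_incidences G (v, e) (w, f) \<longrightarrow> c (v, e) \<noteq> c (w, f))"

lemma adjacent_incidences_sym:
  "adjacent_incidences G i j \<Longrightarrow> adjacent_incidences G j i"
  by (cases i; cases j) (auto simp: adjacent_incidences_def insert_commute)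

text \<open>
  The conditions on the colour \<open>p\<close> of the incidence of \<open>e\<close> at \<open>u\<close> are asymmetric: it must avoid both incidences
  of every edge at \<open>u\<close>, but only the incidence at \<open>v\<close> of an edge at \<open>v\<close>, since arcs
  from different vertices into \<open>v\<close> do not conflict.
\<close>

lemma proper_on_insert:
  assumes c: "proper_on F c" and e: "e \<notin> F" "ends G e = {u, v}" "u \<noteq> v"
    and "p \<noteq> q"
    and p: "\<And>f z. f \<in> F \<Longrightarrow> u \<in> ends G f \<Longrightarrow> z \<in> ends G f \<Longrightarrow> p \<noteq> c (z, f)"
      "\<And>f. f \<in> F \<Longrightarrow> v \<in> ends G f \<Longrightarrow> p \<noteq> c (v, f)"
    and q: "\<And>f z. f \<in> F \<Longrightarrow> v \<in> ends G f \<Longrightarrow> z \<in> ends G f \<Longrightarrow> q \<noteq> c (z, f)"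
      "\<And>f. f \<in> F \<Longrightarrow> u \<in> ends G f \<Longrightarrow> q \<noteq> c (u, f)"
  shows "proper_on (insert e F) (c((u, e) := p, (v, e) := q))"
proof -
  let ?c = "c((u, e) := p, (v, e) := q)"
  have old: "?c (w, f) = c (w, f)" if "f \<in> F" for w f
    using that e(1) by auto
  have new: "?c (x, e) \<noteq> ?c (w, f)"
    if "f \<in> F" "x \<in> ends G e" "w \<in> ends G f" and adj: "adjacent_incidences G (x, e) (w, f)"
    for x w f
  proof -
    have cases: "x = w \<or> ends G e = {x, w} \<or> ends G f = {x, w}"
      using adj that(1) e(1) by (auto simp: adjacent_incidences_def)
    have "x = u \<or> x = v"
      using that(2) e(2) by simp
    then show ?thesis
    proof
      assume 1: "x = u"
      have "w = v" if "ends G e = {x, w}"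
        using that e(2,3) 1 by (simp add: doubleton_eq_iff)
      then have "u \<in> ends G f \<or> w = v"
        using cases that(3) 1 by blast
      then have "p \<noteq> c (w, f)"
        using p(1)[OF that(1) _ that(3)] p(2)[OF that(1)] that(3) by auto
      then show ?thesis
        using 1 e(3) old[OF that(1), of w] by simp
    next
      assume 2: "x = v"
      have "w = u" if "ends G e = {x, w}"
        using that e(2,3) 2 by (simp add: doubleton_eq_iff)
      then have "v \<in> ends G f \<or> w = u"
        using cases that(3) 2 by blast
      then have "q \<noteq> c (w, f)"
        using q(1)[OF that(1) _ that(3)] q(2)[OF that(1)] that(3) by auto
      then show ?thesis
        using 2 old[OF that(1), of w] by simp
    qed
  qed
  show ?thesis
    unfolding proper_on_def
  proof (intro ballI impI)
    fix e' f x w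
    assume *: "e' \<in> insert e F" "f \<in> insert e F" "x \<in> ends G e'" "w \<in> ends G f"
      and adj: "adjacent_incidences G (x, e') (w, f)"
    consider "e' = e" "f = e" | "e' = e" "f \<in> F" | "e' \<in> F" "f = e" | "e' \<in> F" "f \<in> F"
      using * by auto
    then show "?c (x, e') \<noteq> ?c (w, f)"
    proof cases
      case 1
      then show ?thesis
        using * adj e \<open>p \<noteq> q\<close> by (auto simp: adjacent_incidences_def)
    next
      case 2
      then show ?thesis
        using new[of f x w] * adj by simp
    next
      case 3
      then show ?thesis
        using new[of e' w x] * adjacent_incidences_sym[OF adj] by (simp add: eq_commute)
    next
      case 4
      then show ?thesis
        using c * adj old by (auto simp: proper_on_def)
    qed
  qed
qed

lemma free_colour:
  assumes "finite K" "card K \<le> 2"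
  obtains p :: nat where "k \<le> p" "p < k + 3" "p \<notin> K"
proof -
  have "\<not> {k..<k+3} \<subseteq> K"
    using card_mono[OF assms(1), of "{k..<k+3}"] assms(2) by auto
  then obtain p where "p \<in> {k..<k+3}" "p \<notin> K"
    by blast
  then show ?thesis
    using that[of p] by simp
qed

text \<open>
  Let \<open>e = vw\<close> be pendant at \<open>v\<close>. At most one other edge \<open>f\<close> meets \<open>e\<close>, at \<open>w\<close>. The incidence of
  \<open>e\<close> at \<open>w\<close> avoids the two colours of \<open>f\<close>; the incidence at \<open>v\<close> avoids this new colour and
  the colour of \<open>f\<close> at \<open>w\<close>. Both leave one colour out of three.
\<close>

lemma linear_forest_three_colours:
  assumes "linear_forest F"
  shows "\<exists>c. proper_on F c \<and> (\<forall>i. k \<le> c i \<and> c i < k + 3)"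
  using assms
proof (induction "card F" arbitrary: F)
  case 0
  then have "F = {}"
    using finite_edges by (auto simp: linear_forest_def dest: finite_subset)
  then show ?case
    by (auto simp: proper_on_def intro!: exI[of _ "\<lambda>_. k"])
next
  case (Suc n)
  have F: "F \<subseteq> edges G" "F \<noteq> {}" "finite F"
    using Suc.prems Suc.hyps(2) finite_edges by (auto simp: linear_forest_def dest: finite_subset)
  have "acyclic_edges F"
    using Suc.prems by (simp add: linear_forest_def)
  then have "\<exists>v. deg F v = 1"
    using F(2) unfolding acyclic_edges_def by (metis subset_refl)
  then obtain v where v: "deg F v = 1" ..
  obtain e where e: "e \<in> F" "v \<in> ends G e"
    using deg_eq_1_ex[OF v] by blast
  have only_e: "f = e" if "f \<in> F" "v \<in> ends G f" for f
    using deg_eq_1_unique[OF v that e] .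
  obtain w where w: "ends G e = {v, w}" "v \<noteq> w"
    using other_end[of e v] e(1,2) F(1) by blast
  let ?F = "F - {e}"
  have "linear_forest ?F"
    using Suc.prems by (rule linear_forest_subset) auto
  moreover have "n = card ?F"
    using Suc.hyps(2) e(1) F(3) by simp
  ultimately obtain c where c: "proper_on ?F c" "\<forall>i. k \<le> c i \<and> c i < k + 3"
    using Suc.hyps(1)[of ?F] by blast
  have "deg (insert e ?F) w \<le> 2"
    using Suc.prems e(1) by (simp add: linear_forest_def insert_absorb)
  then have "card (star ?F w) \<le> 1"
    using F(1) w by (subst (asm) deg_insert) (auto simp: deg_def)
  moreover have "finite (star ?F w)"
    using F(1) by (intro finite_star) auto
  ultimately have "star ?F w = {} \<or> (\<exists>f. star ?F w = {f})"
    by (cases "card (star ?F w)") (auto simp: card_1_singleton_iff)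
  \<comment> \<open>If no other edge meets \<open>w\<close>, then \<open>f\<close> is arbitrary; likewise \<open>x\<close> below if \<open>w\<close> is not an end of \<open>f\<close>.\<close>
  then obtain f where "star ?F w \<subseteq> {f}"
    by auto
  then have f: "f' = f" if "f' \<in> ?F" "w \<in> ends G f'" for f'
    using that by (auto simp: star_def)
  obtain x where x: "f \<in> F \<Longrightarrow> w \<in> ends G f \<Longrightarrow> ends G f = {w, x}"
  proof (cases "f \<in> F \<and> w \<in> ends G f")
    case True
    then have "f \<in> edges G" "w \<in> ends G f"
      using F(1) by auto
    then show ?thesis
      using other_end that by metis
  next
    case False
    then show ?thesis
      using that by blast
  qed
  obtain p where p: "k \<le> p" "p < k + 3" "p \<notin> {c (w, f), c (x, f)}"
    by (rule free_colour[of "{c (w, f), c (x, f)}" k]) (auto simp: card_insert_if)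
  obtain q where q: "k \<le> q" "q < k + 3" "q \<notin> {c (w, f), p}"
    by (rule free_colour[of "{c (w, f), p}" k]) (auto simp: card_insert_if)
  have "proper_on (insert e ?F) (c((w, e) := p, (v, e) := q))"
  proof (rule proper_on_insert[OF c(1)])
    show "p \<noteq> c (z, f')" if "f' \<in> ?F" "w \<in> ends G f'" "z \<in> ends G f'" for f' z
    proof -
      have "f' = f"
        by (rule f[OF that(1,2)])
      then have "z \<in> {w, x}"
        using x that by simp
      then show ?thesis
        using \<open>f' = f\<close> p(3) by auto
    qed
    show "q \<noteq> c (w, f')" if "f' \<in> ?F" "w \<in> ends G f'" for f'
      using f[OF that] q(3) by auto
  qed (use only_e w q in auto)
  moreover have "insert e ?F = F"
    using e(1) by auto
  ultimately show ?case
    using c(2) p q by (intro exI[of _ "c((w, e) := p, (v, e) := q)"]) auto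
qed

text \<open>
  Keeping the palettes of \<open>A\<close> and \<open>B\<close> apart in the induction hypothesis means that a colour for a
  residual edge only has to be compared with edges of the forest whose palette it belongs to.
\<close>

lemma extend_over_residual_edges:
  assumes A: "linear_forest A" and B: "linear_forest B" and AB: "A \<inter> B = {}"
    and max3: "\<And>z. deg (edges G) z \<le> 3"
    and X: "finite X" "X \<subseteq> edges G - (A \<union> B)" "\<And>e. e \<in> X \<Longrightarrow> residual_edge A B e"
  shows "\<exists>c. proper_on (A \<union> B \<union> X) c \<and> (\<forall>i. c i < 6) \<and>
    (\<forall>f \<in> A. \<forall>z. c (z, f) < 3) \<and> (\<forall>f \<in> B. \<forall>z. 3 \<le> c (z, f))"
  using X
proof (induction X rule: finite_induct)
  case empty
  obtain a where a: "proper_on A a" "\<And>i. a i < 3"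
    using linear_forest_three_colours[OF A, of 0] by auto
  obtain b where b: "proper_on B b" "\<And>i. 3 \<le> b i" "\<And>i. b i < 6"
    using linear_forest_three_colours[OF B, of 3] by auto
  let ?c = "\<lambda>i. if snd i \<in> A then a i else b i"
  have "a i \<noteq> b j" "b i \<noteq> a j" for i j
    using a(2)[of i] b(2)[of j] a(2)[of j] b(2)[of i] by auto
  then have "proper_on (A \<union> B) ?c"
    using a(1) b(1) AB unfolding proper_on_def by auto
  moreover have "?c i < 6" for i
    using a(2)[of i] b(3)[of i] by auto
  ultimately show ?case
    using a(2) b(2) AB by (intro exI[of _ ?c]) auto
next
  case (insert e X)
  let ?F = "A \<union> B \<union> X"
  obtain c where c: "proper_on ?F c" "\<And>i. c i < 6"
      "\<And>f z. f \<in> A \<Longrightarrow> c (z, f) < 3" "\<And>f z. f \<in> B \<Longrightarrow> 3 \<le> c (z, f)"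
    using insert.IH insert.prems by auto
  have AE: "A \<subseteq> edges G" and BE: "B \<subseteq> edges G"
    using A B by (auto simp: linear_forest_def)
  have e: "e \<in> edges G" "e \<notin> ?F"
    using insert.hyps insert.prems(1) by auto
  obtain u v where uv: "ends G e = {u, v}" "u \<noteq> v" and
    types: "deg A u = 2 \<and> deg B u = 0 \<and> deg A v = 0 \<and> deg B v = 2 \<or>
      deg A u = 1 \<and> deg B u = 1 \<and> deg A v = 1 \<and> deg B v = 1 \<and>
      (\<exists>g \<in> A. ends G g = {u, v}) \<and> (\<exists>h \<in> B. ends G h = {u, v})"
    using insert.prems(2)[of e] unfolding residual_edge_def by blast
  \<comment> \<open>An edge of \<open>X\<close> meeting \<open>e\<close> would be the fourth edge at the common end.\<close>
  have F: "f \<in> A \<union> B" if "f \<in> ?F" "z \<in> ends G f" "z \<in> {u, v}" for f z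
  proof (rule ccontr)
    assume f: "f \<notin> A \<union> B"
    have ne: "e \<noteq> f"
      using that(1) e(2) by auto
    have f': "f \<in> edges G"
      using that(1) f insert.prems(1) by auto
    have "deg (insert e (insert f (A \<union> B))) z = deg A z + deg B z + 2"
      using f e f' ne AE BE AB that(2,3) uv(1) by (auto simp: deg_insert deg_Un)
    moreover have "deg A z + deg B z = 2"
      using types that(3) by auto
    moreover have "deg (insert e (insert f (A \<union> B))) z \<le> deg (edges G) z"
      using AE BE e f' by (intro deg_mono) auto
    ultimately show False
      using max3[of z] by linarith
  qed
  have card_K: "finite ((\<lambda>f. c (z, f)) ` star E z)" "card ((\<lambda>f. c (z, f)) ` star E z) \<le> 2"
    if "linear_forest E" for E z
  proof -
    have fin: "finite (star E z)" and "card (star E z) \<le> 2"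
      using that by (auto simp: linear_forest_def finite_star deg_def)
    then show "finite ((\<lambda>f. c (z, f)) ` star E z)" "card ((\<lambda>f. c (z, f)) ` star E z) \<le> 2"
      using card_image_le[OF fin, of "\<lambda>f. c (z, f)"] by auto
  qed
  have "\<exists>p q. p < 6 \<and> q < 6 \<and> proper_on (insert e ?F) (c((u, e) := p, (v, e) := q))"
    using types
  proof
    assume t: "deg A u = 2 \<and> deg B u = 0 \<and> deg A v = 0 \<and> deg B v = 2"
    \<comment> \<open>The palettes are crossed: the incidence at \<open>u\<close>, where \<open>A\<close> occurs, gets a colour of \<open>B\<close>.\<close>
    obtain p where p: "3 \<le> p" "p < 6" "p \<notin> (\<lambda>f. c (v, f)) ` star B v"
      using free_colour[OF card_K[OF B, of v], of 3] by auto
    obtain q where q: "q < 3" "q \<notin> (\<lambda>f. c (u, f)) ` star A u"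
      using free_colour[OF card_K[OF A, of u], of 0] by auto
    have atu: "f \<in> A" if "f \<in> ?F" "u \<in> ends G f" for f
      using F[OF that] that t deg_0_iff[OF BE] by auto
    have atv: "f \<in> B" if "f \<in> ?F" "v \<in> ends G f" for f
      using F[OF that] that t deg_0_iff[OF AE] by auto
    have "proper_on (insert e ?F) (c((u, e) := p, (v, e) := q))"
    proof (rule proper_on_insert[OF c(1) e(2) uv])
      show "p \<noteq> q"
        using p q by simp
      show "p \<noteq> c (z, f)" if "f \<in> ?F" "u \<in> ends G f" for f z
        using c(3)[OF atu[OF that], of z] p by simp
      show "q \<noteq> c (z, f)" if "f \<in> ?F" "v \<in> ends G f" for f z
        using c(4)[OF atv[OF that], of z] q by simp
      show "p \<noteq> c (v, f)" if "f \<in> ?F" "v \<in> ends G f" for f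
        using atv[OF that] that p(3) by (auto simp: star_def)
      show "q \<noteq> c (u, f)" if "f \<in> ?F" "u \<in> ends G f" for f
        using atu[OF that] that q(2) by (auto simp: star_def)
    qed
    then show ?thesis
      using p q by (intro exI[of _ p] exI[of _ q]) auto
  next
    assume t: "deg A u = 1 \<and> deg B u = 1 \<and> deg A v = 1 \<and> deg B v = 1 \<and>
      (\<exists>g \<in> A. ends G g = {u, v}) \<and> (\<exists>h \<in> B. ends G h = {u, v})"
    then obtain g h where g: "g \<in> A" "ends G g = {u, v}" and h: "h \<in> B" "ends G h = {u, v}"
      by blast
    have A_only: "f = g" if "f \<in> A" "z \<in> ends G f" "z \<in> {u, v}" for f z
      using t that g by (intro deg_eq_1_unique[of A z]) auto
    have B_only: "f = h" if "f \<in> B" "z \<in> ends G f" "z \<in> {u, v}" for f z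
      using t that h by (intro deg_eq_1_unique[of B z]) auto
    have pair: "finite {i, j}" "card {i, j} \<le> 2" for i j :: nat
      by (simp_all add: card_insert_if)
    obtain p where p: "p < 3" "p \<notin> {c (u, g), c (v, g)}"
      using free_colour[OF pair, of 0] by (metis add_0)
    obtain q where q: "3 \<le> q" "q < 3 + 3" "q \<notin> {c (u, h), c (v, h)}"
      using free_colour[OF pair, of 3] by metis
    have ok: "p \<noteq> c (z, f) \<and> q \<noteq> c (z, f)"
      if "f \<in> ?F" "y \<in> ends G f" "z \<in> ends G f" "y \<in> {u, v}" for f y z
    proof -
      have "f \<in> A \<union> B"
        using F[OF that(1,2,4)] .
      moreover have "f \<in> A \<Longrightarrow> f = g" "f \<in> B \<Longrightarrow> f = h"
        using A_only[OF _ that(2,4)] B_only[OF _ that(2,4)] by simp_all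
      ultimately consider "f \<in> A" "f = g" | "f \<in> B" "f = h"
        by blast
      then show ?thesis
      proof cases
        case 1
        then show ?thesis
          using c(3)[of f z] that(3) g p q by auto
      next
        case 2
        then show ?thesis
          using c(4)[of f z] that(3) h p q by auto
      qed
    qed
    have "proper_on (insert e ?F) (c((u, e) := p, (v, e) := q))"
      using ok p q by (intro proper_on_insert[OF c(1) e(2) uv]) auto
    then show ?thesis
      using p q by (intro exI[of _ p] exI[of _ q]) auto
  qed
  then obtain p q where pq: "p < 6" "q < 6"
    and proper: "proper_on (insert e ?F) (c((u, e) := p, (v, e) := q))"
    by blast
  have "insert e ?F = A \<union> B \<union> insert e X"
    by auto
  with proper have "proper_on (A \<union> B \<union> insert e X) (c((u, e) := p, (v, e) := q))"
    by metis
  moreover have "(c((u, e) := p, (v, e) := q)) i < 6" for i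
    using pq c(2) by simp
  moreover have "(c((u, e) := p, (v, e) := q)) (z, f) = c (z, f)" if "f \<in> A \<union> B" for f z
    using that e(2) by auto
  ultimately show ?case
    using c(3,4) by (metis UnI1 UnI2)
qed

end

theorem corollary1:
  fixes G :: "('v, 'e) multigraph"
  assumes "finite_loopless_multigraph G"
    and "max_degree G \<le> 3"
  shows "\<exists>c :: 'v \<times> 'e \<Rightarrow> nat. incidence_coloring G c \<and> card (c ` incidences G) \<le> 6"
proof -
  interpret finite_loopless_multigraph G
    by fact
  have max3: "deg (edges G) z \<le> 3" for z
  proof (cases "z \<in> verts G")
    case True
    then have "degree G z \<le> max_degree G"
      using finite_verts by (auto simp: max_degree_def)
    then show ?thesis
      using assms(2) by (simp add: deg_def star_def degree_def)
  next
    case False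
    then have "deg (edges G) z = 0"
      using ends_subset_verts by (auto simp: deg_0_iff)
    then show ?thesis
      by simp
  qed
  obtain A B where A: "linear_forest A" and B: "linear_forest B" and AB: "A \<inter> B = {}"
    and rest: "\<And>e. e \<in> edges G \<Longrightarrow> e \<notin> A \<union> B \<Longrightarrow> residual_edge A B e"
    using exists_forests_with_residual_rest[OF max3] by blast
  let ?X = "edges G - (A \<union> B)"
  obtain c where c: "proper_on (A \<union> B \<union> ?X) c" "\<And>i. c i < 6"
    using extend_over_residual_edges[OF A B AB max3, of ?X] finite_edges rest by auto
  have "A \<union> B \<union> ?X = edges G"
    using A B by (auto simp: linear_forest_def)
  then have "incidence_coloring G c"
    using c(1) by (auto simp: incidence_coloring_def proper_on_def incidences_def)
  moreover have "card (c ` incidences G) \<le> 6"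
    using card_mono[of "{..<6}" "c ` incidences G"] c(2) by (simp add: image_subset_iff)
  ultimately show ?thesis
    by blast
qed

end
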